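(* The variance of $Y_n$ satisfies, as $n\to\infty$, $$\mathrm{Var}(Y_n)=O\left(\frac{n^4}{(\log n)^4}\right).$$
   Context: $\Pi_n$ is the set of all partitions of $[n]=\{1,\dots,n\}$. For $\pi\in\Pi_n$, the chords of its circular representation are obtained by placing $1,\dots,n$ in order on a circle and drawing each block as the convex polygon on its elements: a block $\{b_1<\dots<b_m\}$ contributes no chord if $m=1$, the single chord $\{b_1,b_2\}$ if $m=2$, and the $m$ chords $\{b_1,b_2\},\dots,\{b_{m-1},b_m\},\{b_1,b_m\}$ if $m\ge3$. $\mathrm{cr}^{(c)}(\pi)$ is the number of (unordered) pairs of crossing chords, i.e. pairs of chords $\{i,j\},\{i',j'\}$ with $i<i'<j<j'$. $Y_n$ is the random variable equal to $\mathrm{cr}^{(c)}(\pi)$ for $\pi$ uniformly distributed on $\Pi_n$. *)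

theory Defs
  imports "HOL-Probability.Probability" "HOL-Library.Disjoint_Sets" "HOL-Library.Landau_Symbols"
begin

definition set_partitions :: "nat \<Rightarrow> nat set set set" where
  "set_partitions n = {P. partition_on {1..n} P}"

text \<open>
  Chords are unordered pairs, encoded as two-element sets. The list \<open>b\<close> enumerates the
  block in increasing order, indexed from 0. The closing chord is present only for blocks
  with at least three elements.
\<close>

definition block_chords :: "nat set \<Rightarrow> nat set set" where
  "block_chords B =
    (let b = sorted_list_of_set B; m = length b
     in {{b ! k, b ! (k + 1)} | k. k + 1 < m} \<union> (if m \<ge> 3 then {{b ! 0, b ! (m - 1)}} else {}))"

definition circular_chords :: "nat set set \<Rightarrow> nat set set" where
  "circular_chords P = (\<Union>B\<in>P. block_chords B)"

text \<open>
  This relation is oriented (the chord with the smallest endpoint comes first); symmetry is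
  restored by counting unordered pairs of chords below.
\<close>

definition chords_cross :: "nat set \<Rightarrow> nat set \<Rightarrow> bool" where
  "chords_cross c c' \<longleftrightarrow>
    (\<exists>i j i' j'. c = {i, j} \<and> c' = {i', j'} \<and> i < i' \<and> i' < j \<and> j < j')"

definition circular_crossings :: "nat set set \<Rightarrow> nat" where
  "circular_crossings P =
    card {{c, c'} | c c'. c \<in> circular_chords P \<and> c' \<in> circular_chords P \<and> chords_cross c c'}"

lemma finite_set_partitions: "finite (set_partitions n)"
proof (rule finite_subset)
  show "set_partitions n \<subseteq> Pow (Pow {1..n})"
    unfolding set_partitions_def partition_on_def by blast
qed simp

lemma set_partitions_nonempty: "set_partitions n \<noteq> {}"
proof -
  have "partition_on {1..n} ((\<lambda>x. {x}) ` {1..n})"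
    by (auto simp: partition_on_def disjoint_def)
  then show ?thesis
    by (auto simp: set_partitions_def)
qed

end

theory Submission
  imports Defs "HOL-Real_Asymp.Real_Asymp"
begin

text \<open>
  Write \<open>w m = m ^ n / m!\<close>. A partition of \<open>{1..n}\<close> with \<open>k\<close> blocks is the kernel (the partition
  into positions carrying equal letters) of \<open>m (m - 1) ... (m - k + 1)\<close> words of length \<open>n\<close> over
  \<open>m\<close> letters. Divided by \<open>m!\<close> and summed over \<open>m\<close>, this gives \<open>e\<close> whatever \<open>k\<close> is. So a uniform
  random partition is the kernel of a uniform random word whose alphabet size \<open>M\<close> is itself random,
  with weights proportional to \<open>w\<close>; this is the idea behind Dobinski's formula for the Bell numbers
  (\<open>dobinski_sums\<close>). It splits the variance into two parts.
  
  Fixed alphabet: changing one letter of a word creates at most six chords and destroys at most six,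
  and there are never more than \<open>n\<close> chords, so the number of crossings moves by at most \<open>6 n\<close>
  (\<open>circular_crossings_change_le\<close>). The letters are independent, so a bound of Efron-Stein type shows
  that the conditional variance is at most \<open>n (6 n)\<^sup>2\<close> (\<open>word_mean_square_le\<close>).
  
  Random alphabet: a uniform letter out of \<open>m'\<close> lies among the first \<open>m \<le> m'\<close> with probability
  \<open>m / m'\<close>, so passing from one alphabet to the other letter by letter changes the mean number of
  crossings by at most \<open>2 n (6 n) (m' - m) / m'\<close> (\<open>word_mean_alphabet_le\<close>). The weights are unimodal,
  and away from their mode \<open>k\<close> they decay at least as fast as those of a Poisson law with mean about
  \<open>k\<close>; hence the mean of \<open>(M - k)\<^sup>2\<close> is at most \<open>12 k\<close> (\<open>weight_concentration\<close>), and the fluctuation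
  of \<open>M\<close> contributes a constant times \<open>n ^ 4 / k\<close>.
  
  Finally \<open>k \<ge> sqrt n\<close> by Bernoulli's inequality (\<open>le_weight_mode_square\<close>). Altogether the variance
  is of order at most \<open>n ^ 3 * sqrt n\<close>, a power of \<open>n\<close> below \<open>n ^ 4\<close>, and this gain absorbs the
  logarithms.
\<close>

section \<open>Means over uniform random words\<close>

definition words :: "nat \<Rightarrow> nat \<Rightarrow> nat list set" where
  "words m n = {xs. length xs = n \<and> set xs \<subseteq> {..<m}}"

definition word_mean :: "nat \<Rightarrow> nat \<Rightarrow> (nat list \<Rightarrow> real) \<Rightarrow> real" where
  "word_mean m n h = (\<Sum>xs\<in>words m n. h xs) / real m ^ n"

definition bounded_differences :: "nat \<Rightarrow> real \<Rightarrow> (nat list \<Rightarrow> real) \<Rightarrow> bool" where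
  "bounded_differences n L h \<longleftrightarrow>
    (\<forall>xs i a. length xs = n \<longrightarrow> i < n \<longrightarrow> \<bar>h xs - h (xs[i := a])\<bar> \<le> L)"

lemma finite_words: "finite (words m n)"
  using finite_lists_length_eq[of "{..<m}" n] by (simp add: words_def conj_commute)

lemma card_words: "card (words m n) = m ^ n"
  using card_lists_length_eq[of "{..<m}" n] by (simp add: words_def conj_commute)

lemma sum_words_Suc:
  "(\<Sum>xs\<in>words m (Suc n). h xs) = (\<Sum>a<m. \<Sum>xs\<in>words m n. h (a # xs))"
proof -
  have "words m (Suc n) = (\<lambda>(a, xs). a # xs) ` ({..<m} \<times> words m n)"
    by (auto simp: words_def length_Suc_conv image_iff)
  moreover have "inj_on (\<lambda>(a, xs). a # xs) ({..<m} \<times> words m n)"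
    by (auto simp: inj_on_def)
  ultimately show ?thesis
    by (simp add: sum.reindex sum.cartesian_product case_prod_unfold)
qed

lemma word_mean_0: "word_mean m 0 h = h []"
proof -
  have "words m 0 = {[]}" by (auto simp: words_def)
  then show ?thesis by (simp add: word_mean_def)
qed

lemma word_mean_Suc:
  "word_mean m (Suc n) h = (\<Sum>a<m. word_mean m n (\<lambda>xs. h (a # xs))) / real m"
  by (simp add: word_mean_def sum_words_Suc sum_divide_distrib mult.commute)

lemma word_mean_diff_le:
  assumes "m > 0" and "\<And>xs. length xs = n \<Longrightarrow> \<bar>f xs - g xs\<bar> \<le> c"
  shows "\<bar>word_mean m n f - word_mean m n g\<bar> \<le> c"
proof -
  have "\<bar>(\<Sum>xs\<in>words m n. f xs) - (\<Sum>xs\<in>words m n. g xs)\<bar> \<le> (\<Sum>xs\<in>words m n. c)"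
    unfolding sum_subtractf[symmetric]
    by (rule order_trans[OF sum_abs sum_mono]) (use assms in \<open>auto simp: words_def\<close>)
  then have "\<bar>(\<Sum>xs\<in>words m n. f xs) - (\<Sum>xs\<in>words m n. g xs)\<bar> \<le> real m ^ n * c"
    by (simp add: card_words)
  then show ?thesis
    using assms(1) by (simp add: word_mean_def diff_divide_distrib[symmetric] field_simps)
qed

lemma bounded_differences_Cons:
  assumes "bounded_differences (Suc n) L h"
  shows "bounded_differences n L (\<lambda>xs. h (a # xs))"
  unfolding bounded_differences_def
proof (intro allI impI)
  fix xs :: "nat list" and i b
  assume "length xs = n" "i < n"
  then show "\<bar>h (a # xs) - h (a # xs[i := b])\<bar> \<le> L"
    using assms[unfolded bounded_differences_def, rule_format, of "a # xs" "Suc i" b] by simp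
qed

lemma bounded_differences_head:
  assumes "bounded_differences (Suc n) L h" "length xs = n"
  shows "\<bar>h (a # xs) - h (b # xs)\<bar> \<le> L"
  using assms(1)[unfolded bounded_differences_def, rule_format, of "a # xs" 0 b] assms(2) by simp

text \<open>
  Efron-Stein with the crude constant 1, in the form in which the two parts of the variance are
  already combined. Induction on the word length: given the first letter \<open>a\<close>, the remaining letters
  contribute the bound for length \<open>n\<close>, and the conditional means \<open>\<phi> a\<close> lie within \<open>L\<close> of their
  average \<open>\<mu>\<close>, because changing the first letter changes the function by at most \<open>L\<close>.
\<close>
lemma word_mean_square_le:
  assumes m: "m > 0" and "bounded_differences n L h"
  shows "word_mean m n (\<lambda>xs. (h xs - c)\<^sup>2) \<le> real n * L\<^sup>2 + (word_mean m n h - c)\<^sup>2"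
  using assms(2)
proof (induction n arbitrary: h)
  case 0
  then show ?case by (simp add: word_mean_0)
next
  case (Suc n)
  define \<phi> where "\<phi> a = word_mean m n (\<lambda>xs. h (a # xs))" for a
  define \<mu> where "\<mu> = (\<Sum>a<m. \<phi> a) / m"
  have sum\<phi>: "(\<Sum>a<m. \<phi> a) = m * \<mu>" using m by (simp add: \<mu>_def)
  have \<mu>: "word_mean m (Suc n) h = \<mu>" by (simp add: word_mean_Suc \<mu>_def \<phi>_def)
  have osc: "\<bar>\<phi> a - \<phi> b\<bar> \<le> L" for a b
    unfolding \<phi>_def using bounded_differences_head[OF Suc.prems]
    by (intro word_mean_diff_le m)
  have dev: "\<bar>\<phi> a - \<mu>\<bar> \<le> L" for a
  proof -
    have "m * (\<phi> a - \<mu>) = (\<Sum>b<m. \<phi> a - \<phi> b)"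
      by (simp add: sum_subtractf sum\<phi> algebra_simps)
    also have "\<bar>\<dots>\<bar> \<le> (\<Sum>b<m. L)"
      by (rule order_trans[OF sum_abs sum_mono]) (rule osc)
    finally show ?thesis using m by (simp add: abs_mult)
  qed
  have "(\<Sum>a<m. word_mean m n (\<lambda>xs. (h (a # xs) - c)\<^sup>2)) \<le> (\<Sum>a<m. n * L\<^sup>2 + (\<phi> a - c)\<^sup>2)"
    unfolding \<phi>_def by (intro sum_mono Suc.IH bounded_differences_Cons Suc.prems)
  \<comment> \<open>The cross terms below vanish because the deviations from the average sum to zero.\<close>
  also have "(\<Sum>a<m. n * L\<^sup>2 + (\<phi> a - c)\<^sup>2)
      = (\<Sum>a<m. n * L\<^sup>2 + (\<phi> a - \<mu>)\<^sup>2 + (\<mu> - c)\<^sup>2 + 2 * (\<mu> - c) * (\<phi> a - \<mu>))"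
    by (intro sum.cong refl) (simp add: power2_eq_square algebra_simps)
  also have "\<dots> = (\<Sum>a<m. n * L\<^sup>2 + (\<phi> a - \<mu>)\<^sup>2 + (\<mu> - c)\<^sup>2)"
    by (simp add: sum.distrib sum_distrib_left[symmetric] sum_subtractf sum\<phi>)
  also have "\<dots> \<le> (\<Sum>a<m. n * L\<^sup>2 + L\<^sup>2 + (\<mu> - c)\<^sup>2)"
    by (intro sum_mono add_mono order_refl) (use dev in \<open>simp add: abs_le_square_iff[symmetric]\<close>, metis abs_ge_zero abs_of_nonneg order_trans dev)
  also have "\<dots> = m * (real (Suc n) * L\<^sup>2 + (\<mu> - c)\<^sup>2)"
    by (simp add: algebra_simps)
  finally show ?case
    using m by (simp add: word_mean_Suc[of m n "\<lambda>xs. (h xs - c)\<^sup>2"] \<mu> field_simps)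
qed

text \<open>
  The letters are exchanged one at a time, and each exchange costs at most \<open>2 L (m' - m) / m'\<close>: once
  the function is normalised to vanish at letter 0, it is bounded by \<open>L\<close>, and the uniform laws on
  \<open>m\<close> and \<open>m'\<close> letters have total variation distance \<open>(m' - m) / m'\<close>. The larger alphabet in the
  denominator is what later makes the bound uniform over all alphabets, small ones included.
\<close>
lemma word_mean_alphabet_le:
  assumes m: "0 < m" "m \<le> m'" and "bounded_differences n L h"
  shows "\<bar>word_mean m' n h - word_mean m n h\<bar> \<le> 2 * real n * L * (real m' - real m) / m'"
  using assms(3)
proof (induction n arbitrary: h)
  case 0
  then show ?case by (simp add: word_mean_0)
next
  case (Suc n)
  define \<phi> where "\<phi> a = word_mean m n (\<lambda>xs. h (a # xs))" for a
  define \<phi>' where "\<phi>' a = word_mean m' n (\<lambda>xs. h (a # xs))" for a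
  define \<psi> where "\<psi> a = \<phi> a - \<phi> 0" for a
  have L: "\<bar>\<psi> a\<bar> \<le> L" for a
    unfolding \<phi>_def \<psi>_def using bounded_differences_head[OF Suc.prems]
    by (intro word_mean_diff_le m)
  define D where "D = 2 * real n * L * (real m' - real m) / m'"
  have "\<bar>\<phi>' a - \<phi> a\<bar> \<le> D" for a
    unfolding \<phi>_def \<phi>'_def D_def by (intro Suc.IH bounded_differences_Cons Suc.prems)
  then have "\<bar>\<Sum>a<m'. \<phi>' a - \<phi> a\<bar> \<le> (\<Sum>a<m'. D)"
    by (intro order_trans[OF sum_abs sum_mono])
  then have 1: "\<bar>(\<Sum>a<m'. \<phi>' a) / m' - (\<Sum>a<m'. \<phi> a) / m'\<bar> \<le> D"
    using m by (simp add: sum_subtractf diff_divide_distrib[symmetric] field_simps)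
  have split: "(\<Sum>a<m'. \<psi> a) = (\<Sum>a<m. \<psi> a) + (\<Sum>a\<in>{m..<m'}. \<psi> a)"
    using sum.atLeastLessThan_concat[of 0 m m' \<psi>] m by (simp add: atLeast0LessThan)
  have a: "\<bar>\<Sum>a<m. \<psi> a\<bar> \<le> m * L"
    using order_trans[OF sum_abs sum_mono, of "{..<m}" \<psi> "\<lambda>_. L"] L by simp
  have b: "\<bar>\<Sum>a\<in>{m..<m'}. \<psi> a\<bar> \<le> (real m' - real m) * L"
    using order_trans[OF sum_abs sum_mono, of "{m..<m'}" \<psi> "\<lambda>_. L"] L m by (simp add: of_nat_diff)
  have "(\<Sum>a<m'. \<phi> a) / m' - (\<Sum>a<m. \<phi> a) / m = (\<Sum>a<m'. \<psi> a) / m' - (\<Sum>a<m. \<psi> a) / m"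
    using m by (simp add: \<psi>_def sum_subtractf diff_divide_distrib)
  also have "\<dots> = (\<Sum>a\<in>{m..<m'}. \<psi> a) / m' - (real m' - real m) / (m' * real m) * (\<Sum>a<m. \<psi> a)"
    unfolding split using m by (simp add: field_simps)
  also have "\<bar>\<dots>\<bar> \<le> \<bar>\<Sum>a\<in>{m..<m'}. \<psi> a\<bar> / m' + (real m' - real m) / (m' * real m) * \<bar>\<Sum>a<m. \<psi> a\<bar>"
    using m by (intro order_trans[OF abs_triangle_ineq4]) (simp add: abs_mult)
  also have "\<dots> \<le> (real m' - real m) * L / m' + (real m' - real m) / (m' * real m) * (m * L)"
    using m a b by (intro add_mono divide_right_mono mult_left_mono) auto
  also have "\<dots> = 2 * L * (real m' - real m) / m'"
    using m by (simp add: field_simps)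
  finally have 2: "\<bar>(\<Sum>a<m'. \<phi> a) / m' - (\<Sum>a<m. \<phi> a) / m\<bar> \<le> 2 * L * (real m' - real m) / m'" .
  have "\<bar>(\<Sum>a<m'. \<phi>' a) / m' - (\<Sum>a<m. \<phi> a) / m\<bar> \<le> D + 2 * L * (real m' - real m) / m'"
    using 1 2 by linarith
  also have "\<dots> = 2 * real (Suc n) * L * (real m' - real m) / m'"
    by (simp add: D_def add_divide_distrib[symmetric] algebra_simps)
  finally show ?case
    by (simp add: word_mean_Suc \<phi>_def \<phi>'_def)
qed

section \<open>Concentration of the random alphabet size\<close>

text \<open>
  The second moment of a one-sided tail, measured from its starting point. The hypothesis says that
  \<open>s\<close> decays at least as fast as a Poisson tail of mean about \<open>K\<close> beyond the mode. Multiplying it by \<open>j\<close> and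
  summing by parts trades one factor \<open>j\<close> for a factor \<open>K\<close>, so the second moment is of order \<open>K\<close>
  times the total mass. It applies to both sides of the mode.
\<close>
lemma weighted_squares_le:
  fixes s :: "nat \<Rightarrow> real"
  assumes nonneg: "\<And>j. 0 \<le> s j" and "0 \<le> K"
    and decay: "\<And>j. real j * s (Suc j) \<le> K * (s j - s (Suc j))"
  shows "(\<Sum>j<J. (real (Suc j))\<^sup>2 * s (Suc j)) \<le> (2 * K + 2) * (\<Sum>j\<le>J. s j)"
proof -
  have parts: "(\<Sum>j<J. real j * (s j - s (Suc j))) \<le> (\<Sum>j\<le>J. s j)" for J
  proof -
    have "(\<Sum>j<J. real j * (s j - s (Suc j))) + real J * s J = (\<Sum>j<J. s (Suc j))"
    proof (induction J)
      case (Suc J)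
      then show ?case unfolding sum.lessThan_Suc of_nat_Suc by (simp add: algebra_simps)
    qed simp
    also have "\<dots> \<le> (\<Sum>j\<le>J. s j)"
      unfolding sum.atMost_shift using nonneg[of 0] by linarith
    finally show ?thesis
      using mult_nonneg_nonneg[OF of_nat_0_le_iff[of J] nonneg[of J]] by linarith
  qed
  have "(\<Sum>j<J. (real (Suc j))\<^sup>2 * s (Suc j)) \<le> (\<Sum>j<J. 2 * K * (real j * (s j - s (Suc j))) + 2 * s (Suc j))"
  proof (rule sum_mono)
    fix j
    have "(real (Suc j))\<^sup>2 \<le> 2 * (real j)\<^sup>2 + 2"
      using zero_le_power2[of "real j - 1"] by (simp add: power2_eq_square algebra_simps)
    then have "(real (Suc j))\<^sup>2 * s (Suc j) \<le> (2 * (real j)\<^sup>2 + 2) * s (Suc j)"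
      by (rule mult_right_mono) (rule nonneg)
    also have "\<dots> = 2 * (real j * (real j * s (Suc j))) + 2 * s (Suc j)"
      by (simp add: power2_eq_square algebra_simps)
    also have "\<dots> \<le> 2 * (real j * (K * (s j - s (Suc j)))) + 2 * s (Suc j)"
      using mult_left_mono[OF decay[of j], of "real j"] by simp
    finally show "(real (Suc j))\<^sup>2 * s (Suc j) \<le> 2 * K * (real j * (s j - s (Suc j))) + 2 * s (Suc j)"
      by (simp add: mult_ac)
  qed
  also have "\<dots> = 2 * K * (\<Sum>j<J. real j * (s j - s (Suc j))) + 2 * (\<Sum>j<J. s (Suc j))"
    by (simp add: sum.distrib sum_distrib_left)
  also have "\<dots> \<le> 2 * K * (\<Sum>j\<le>J. s j) + 2 * (\<Sum>j\<le>J. s j)"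
  proof (intro add_mono mult_left_mono parts)
    show "(\<Sum>j<J. s (Suc j)) \<le> (\<Sum>j\<le>J. s j)"
      unfolding sum.atMost_shift using nonneg[of 0] by linarith
  qed (use \<open>0 \<le> K\<close> in auto)
  finally show ?thesis by (simp add: algebra_simps)
qed

text \<open>
  Up to the factor \<open>1 / e\<close>, these are the terms of Dobinski's series for the Bell number of \<open>n\<close>.
\<close>

definition dobinski_weight :: "nat \<Rightarrow> nat \<Rightarrow> real" where
  "dobinski_weight n m = real m ^ n / fact m"

text \<open>
  The first descent is a maximum of the weights, since the ratio of successive weights is decreasing.
  Positivity keeps divisions by the mode meaningful for \<open>n = 0\<close> too, where the weights never increase.
\<close>
definition weight_mode :: "nat \<Rightarrow> nat" where
  "weight_mode n = (LEAST m. m > 0 \<and> dobinski_weight n (Suc m) \<le> dobinski_weight n m)"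

lemma dobinski_weight_nonneg: "0 \<le> dobinski_weight n m"
  by (simp add: dobinski_weight_def)

lemma dobinski_weight_Suc_le_iff:
  assumes "m > 0"
  shows "dobinski_weight n (Suc m) \<le> dobinski_weight n m \<longleftrightarrow> (1 + 1 / real m) ^ n \<le> 1 + real m"
proof -
  have "dobinski_weight n (Suc m) = (real m * (1 + 1 / real m)) ^ n / (fact m * (1 + real m))"
  proof -
    have "real m * (1 + 1 / real m) = real (Suc m)" using assms by (simp add: field_simps)
    then show ?thesis by (simp add: dobinski_weight_def mult.commute)
  qed
  also have "\<dots> = dobinski_weight n m * ((1 + 1 / real m) ^ n / (1 + real m))"
    by (simp add: dobinski_weight_def power_mult_distrib)
  finally have eq: "dobinski_weight n (Suc m) = dobinski_weight n m * ((1 + 1 / real m) ^ n / (1 + real m))" .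
  have "dobinski_weight n m > 0" using assms by (simp add: dobinski_weight_def)
  then have "dobinski_weight n (Suc m) \<le> dobinski_weight n m \<longleftrightarrow> (1 + 1 / real m) ^ n / (1 + real m) \<le> 1"
    unfolding eq using mult_le_cancel_left_pos[of _ "(1 + 1 / real m) ^ n / (1 + real m)" 1] by simp
  then show ?thesis by (simp add: divide_le_eq_1)
qed

text \<open>
  A descent exists because the ratio of successive weights, \<open>(1 + 1 / m) ^ n / (m + 1)\<close>, tends to 0.
\<close>
lemma weight_mode:
  shows weight_mode_pos: "weight_mode n > 0"
    and weight_mode_descent: "dobinski_weight n (Suc (weight_mode n)) \<le> dobinski_weight n (weight_mode n)"
proof -
  have "((\<lambda>m. (1 + 1 / real m) ^ n) \<longlongrightarrow> (1 + 0) ^ n) sequentially"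
    by (intro tendsto_intros lim_1_over_n)
  then have "eventually (\<lambda>m. (1 + 1 / real m) ^ n < 2) sequentially"
    by (rule order_tendstoD) simp
  then have "eventually (\<lambda>m. m > 0 \<and> (1 + 1 / real m) ^ n < 2) sequentially"
    using eventually_gt_at_top[of 0] by eventually_elim simp
  then obtain m where "m > 0" "(1 + 1 / real m) ^ n < 2"
    by (blast dest: eventually_happens'[OF sequentially_bot])
  then have "m > 0 \<and> dobinski_weight n (Suc m) \<le> dobinski_weight n m"
    by (simp add: dobinski_weight_Suc_le_iff)
  from LeastI[of "\<lambda>m. m > 0 \<and> dobinski_weight n (Suc m) \<le> dobinski_weight n m", OF this]
  show "weight_mode n > 0" "dobinski_weight n (Suc (weight_mode n)) \<le> dobinski_weight n (weight_mode n)"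
    by (auto simp: weight_mode_def)
qed

lemma weight_ascent:
  assumes "0 < m" "m < weight_mode n"
  shows "dobinski_weight n m \<le> dobinski_weight n (Suc m)"
  using not_less_Least[OF assms(2)[unfolded weight_mode_def]] assms(1) by simp

text \<open>
  At the mode the weights descend, which means \<open>(1 + 1 / m) ^ n \<le> 1 + m\<close>; Bernoulli's inequality bounds the
  left side below by \<open>1 + n / m\<close>. The true order of the mode is \<open>n / ln n\<close>, but any power of \<open>n\<close> is
  enough here.
\<close>
lemma le_weight_mode_square: "n \<le> (weight_mode n)\<^sup>2"
proof -
  let ?m = "weight_mode n"
  have "1 + real n * (1 / ?m) \<le> (1 + 1 / real ?m) ^ n"
    by (rule Bernoulli_inequality) (rule order_trans[of _ 0]; simp)
  also have "\<dots> \<le> 1 + real ?m"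
    using weight_mode_descent[of n] dobinski_weight_Suc_le_iff[OF weight_mode_pos] by blast
  finally have "real n \<le> real ?m * real ?m"
    using weight_mode_pos[of n] by (simp add: field_simps)
  then show ?thesis
    by (simp add: power2_eq_square flip: of_nat_mult)
qed

text \<open>
  The factor \<open>(1 + 1 / m) ^ n\<close> decreases in \<open>m\<close>, so above the mode it is at most its value there, and
  only the factor \<open>1 / (m + 1)\<close> of the ratio needs to be kept. This is the decay of a Poisson law with
  mean \<open>Suc (weight_mode n)\<close>.
\<close>
lemma weight_above_mode:
  assumes "weight_mode n \<le> m"
  shows "real (Suc m) * dobinski_weight n (Suc m) \<le> real (Suc (weight_mode n)) * dobinski_weight n m"
proof -
  let ?k = "weight_mode n"
  have pos: "0 < ?k" "0 < m" using weight_mode_pos[of n] assms by auto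
  have "(1 + 1 / real m) ^ n \<le> (1 + 1 / real ?k) ^ n"
    using pos assms by (intro power_mono add_left_mono divide_left_mono) auto
  also have "\<dots> \<le> 1 + real ?k"
    using weight_mode_descent[of n] dobinski_weight_Suc_le_iff[OF weight_mode_pos] by blast
  finally have le: "(1 + 1 / real m) ^ n \<le> 1 + real ?k" .
  have "real (Suc m) * dobinski_weight n (Suc m) = real (Suc m) ^ n / fact m"
    by (simp add: dobinski_weight_def del: of_nat_Suc)
  also have "real (Suc m) ^ n / fact m = ((1 + 1 / real m) * m) ^ n / fact m"
  proof -
    have "(1 + 1 / real m) * m = real (Suc m)" using pos by (simp add: field_simps)
    then show ?thesis by simp
  qed
  also have "((1 + 1 / real m) * m) ^ n / fact m = (1 + 1 / real m) ^ n * dobinski_weight n m"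
    by (simp add: power_mult_distrib dobinski_weight_def)
  also have "\<dots> \<le> (1 + real ?k) * dobinski_weight n m"
    by (intro mult_right_mono le dobinski_weight_nonneg)
  finally show ?thesis by simp
qed

lemma weight_pred:
  assumes "0 < m"
  shows "dobinski_weight n (m - 1) = real m * (1 - 1 / real m) ^ n * dobinski_weight n m"
proof -
  have "real m * (1 - 1 / real m) ^ n * dobinski_weight n m = (m * (1 - 1 / real m)) ^ n * (real m / fact m)"
    by (simp add: dobinski_weight_def power_mult_distrib)
  also have "m * (1 - 1 / real m) = real (m - 1)" using assms by (simp add: field_simps of_nat_diff)
  also have "real m / fact m = 1 / fact (m - 1)" using assms by (cases m) (auto simp del: of_nat_Suc)
  finally show ?thesis by (simp add: dobinski_weight_def)
qed

text \<open>
  The mirror image: \<open>(1 - 1 / m) ^ n\<close> increases in \<open>m\<close>, so below the mode it is at most its value there,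
  which is at most \<open>1 / weight_mode n\<close> because the weights still ascend just before the mode.
\<close>
lemma weight_below_mode:
  assumes "0 < n" "0 < m" "m \<le> weight_mode n"
  shows "real (weight_mode n) * dobinski_weight n (m - 1) \<le> real m * dobinski_weight n m"
proof -
  let ?k = "weight_mode n"
  have wk: "dobinski_weight n ?k > 0" using weight_mode_pos by (simp add: dobinski_weight_def)
  have "dobinski_weight n (?k - 1) \<le> dobinski_weight n ?k"
  proof (cases "?k = 1")
    case True
    then show ?thesis using assms(1) by (simp add: dobinski_weight_def power_0_left)
  next
    case False
    then show ?thesis using weight_ascent[of "?k - 1" n] weight_mode_pos[of n] by simp
  qed
  then have *: "real ?k * (1 - 1 / real ?k) ^ n \<le> 1"
    unfolding weight_pred[OF weight_mode_pos]
    using wk mult_le_cancel_right_pos[of _ "real ?k * (1 - 1 / real ?k) ^ n" 1] by simp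
  have "(1 - 1 / real m) ^ n \<le> (1 - 1 / real ?k) ^ n"
    using assms by (intro power_mono diff_left_mono divide_left_mono) auto
  then have "real ?k * (1 - 1 / real m) ^ n \<le> 1"
    using * mult_left_mono[of "(1 - 1 / real m) ^ n" "(1 - 1 / real ?k) ^ n" "real ?k"] by simp
  then have "(real ?k * (1 - 1 / real m) ^ n) * (real m * dobinski_weight n m) \<le> 1 * (real m * dobinski_weight n m)"
    by (intro mult_right_mono) (auto simp: dobinski_weight_nonneg)
  then show ?thesis
    unfolding weight_pred[OF \<open>0 < m\<close>] by (simp add: mult_ac)
qed

text \<open>
  The two tails are handled by \<open>weighted_squares_le\<close>, with \<open>K\<close> equal to the mode or its successor. As it
  is the partial sums that are bounded, the convergence of the second moment need not be known
  beforehand.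
\<close>
lemma weight_concentration:
  assumes "0 < n" and total: "(dobinski_weight n) sums W"
  shows "(\<Sum>m<N. dobinski_weight n m * (real m - real (weight_mode n))\<^sup>2)
           \<le> 12 * real (weight_mode n) * W"
proof -
  let ?w = "dobinski_weight n"
  define k where "k = weight_mode n"
  have k: "0 < k" by (simp add: k_def weight_mode_pos)
  have summable: "summable ?w" using total by (rule sums_summable)
  have partial: "sum ?w A \<le> W" if "finite A" for A
    using sum_le_suminf[OF summable that] dobinski_weight_nonneg total by (simp add: sums_iff)
  have Wpos: "0 \<le> W" using partial[of "{}"] by simp
  define d where "d m = ?w m * (real m - real k)\<^sup>2" for m
  have d0: "0 \<le> d m" for m by (simp add: d_def dobinski_weight_nonneg)
  \<comment> \<open>The weights read upwards and downwards from the mode, the latter extended by zeros.\<close>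
  define up where "up j = ?w (k + j)" for j
  define dn where "dn j = (if j \<le> k then ?w (k - j) else 0)" for j
  have "(\<Sum>j<N. (real (Suc j))\<^sup>2 * up (Suc j)) \<le> (2 * (real k + 1) + 2) * (\<Sum>j\<le>N. up j)"
  proof (rule weighted_squares_le)
    fix j
    have "real (Suc (k + j)) * ?w (Suc (k + j)) \<le> real (Suc k) * ?w (k + j)"
      unfolding k_def by (rule weight_above_mode) simp
    then show "real j * up (Suc j) \<le> (real k + 1) * (up j - up (Suc j))"
      by (simp add: up_def algebra_simps)
  qed (auto simp: up_def dobinski_weight_nonneg)
  moreover have "(\<Sum>j\<le>N. up j) \<le> W"
    using partial[of "(\<lambda>j. k + j) ` {..N}"] by (simp add: up_def sum.reindex)
  ultimately have above: "(\<Sum>j<N. (real (Suc j))\<^sup>2 * up (Suc j)) \<le> (2 * (real k + 1) + 2) * W"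
    by (rule order_trans[OF _ mult_left_mono]) simp
  have "(\<Sum>j<k. (real (Suc j))\<^sup>2 * dn (Suc j)) \<le> (2 * real k + 2) * (\<Sum>j\<le>k. dn j)"
  proof (rule weighted_squares_le)
    fix j
    show "real j * dn (Suc j) \<le> real k * (dn j - dn (Suc j))"
    proof (cases "j < k")
      case True
      have "real k * ?w (k - j - 1) \<le> real (k - j) * ?w (k - j)"
        unfolding k_def using True k_def by (intro weight_below_mode assms) auto
      also have "\<dots> = (real k - real j) * ?w (k - j)" using True by (simp add: of_nat_diff)
      finally have 1: "real k * ?w (k - j - 1) \<le> (real k - real j) * ?w (k - j)" .
      note 1
      also have "(real k - real j) * ?w (k - j) \<le> real k * ?w (k - j)"
        by (intro mult_right_mono dobinski_weight_nonneg) simp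
      finally have "?w (k - j - 1) \<le> ?w (k - j)" using k by simp
      then have "real j * ?w (k - j - 1) \<le> real j * ?w (k - j)"
        by (rule mult_left_mono) simp
      then have "real j * ?w (k - j - 1) \<le> real k * ?w (k - j) - real k * ?w (k - j - 1)"
        using 1 by (simp add: algebra_simps)
      then show ?thesis using True by (simp add: dn_def algebra_simps)
    qed (auto simp: dn_def dobinski_weight_nonneg)
  qed (auto simp: dn_def dobinski_weight_nonneg)
  moreover have "(\<Sum>j\<le>k. dn j) \<le> W"
  proof -
    have "(\<Sum>j\<le>k. dn j) = (\<Sum>j\<le>k. ?w j)"
      unfolding dn_def by (rule sum.reindex_bij_witness[of _ "\<lambda>j. k - j" "\<lambda>j. k - j"]) auto
    then show ?thesis using partial[of "{..k}"] by simp
  qed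
  ultimately have below: "(\<Sum>j<k. (real (Suc j))\<^sup>2 * dn (Suc j)) \<le> (2 * real k + 2) * W"
    by (rule order_trans[OF _ mult_left_mono]) simp
  have "(\<Sum>m<N. d m) \<le> (\<Sum>m<k + Suc N. d m)"
    by (intro sum_mono2) (auto simp: d0)
  also have "\<dots> = (\<Sum>m<k. d m) + (\<Sum>j<Suc N. d (k + j))"
    by (induction N) (auto simp: algebra_simps)
  also have "(\<Sum>j<Suc N. d (k + j)) = (\<Sum>j<N. (real (Suc j))\<^sup>2 * up (Suc j))"
    unfolding sum.lessThan_Suc_shift by (simp add: d_def up_def mult.commute)
  also have "(\<Sum>m<k. d m) = (\<Sum>j<k. d (k - Suc j))"
    by (rule sum.nat_diff_reindex[symmetric])
  also have "\<dots> = (\<Sum>j<k. (real (Suc j))\<^sup>2 * dn (Suc j))"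
    by (intro sum.cong refl) (auto simp: d_def dn_def of_nat_diff power2_eq_square algebra_simps)
  finally have "(\<Sum>m<N. d m) \<le> (2 * real k + 2) * W + (2 * (real k + 1) + 2) * W"
    using above below by simp
  also have "\<dots> = (4 * real k + 6) * W" by (simp add: algebra_simps)
  also have "\<dots> \<le> (12 * real k) * W"
    using k Wpos by (intro mult_right_mono) auto
  finally show ?thesis by (simp add: d_def k_def)
qed

section \<open>Chords and crossings of the kernel of a word\<close>

text \<open>
  A description of chords without enumerating the block: either the open interval between the
  endpoints misses the block, or the closed interval contains it. For a block of two elements both
  alternatives give the same chord, which is why no case distinction on the size remains.
\<close>
lemma block_chords_eq:
  assumes "finite B"
  shows "block_chords B = {{p, q} |p q. p \<in> B \<and> q \<in> B \<and> p < q \<and>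
    ((\<forall>r\<in>B. r \<le> p \<or> q \<le> r) \<or> (\<forall>r\<in>B. p \<le> r \<and> r \<le> q))}" (is "_ = ?R")
proof -
  define b where "b = sorted_list_of_set B"
  define m where "m = length b"
  have setb: "set b = B" using assms by (simp add: b_def)
  have less: "b ! i < b ! j \<longleftrightarrow> i < j" if "i < m" "j < m" for i j
    using that strict_sorted_list_of_set[of B] sorted_wrt_nth_less[of "(<)" b]
    by (metis b_def m_def linorder_neqE_nat order_less_asym order_less_irrefl)
  then have le: "b ! i \<le> b ! j \<longleftrightarrow> i \<le> j" if "i < m" "j < m" for i j
    using that by (meson not_le)
  have mem: "r \<in> B \<longleftrightarrow> (\<exists>i<m. r = b ! i)" for r
    by (auto simp: setb[symmetric] in_set_conv_nth m_def)
  have memI: "b ! i \<in> B" if "i < m" for i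
    using that mem by blast
  have chords: "block_chords B = {{b ! k, b ! (k + 1)} | k. k + 1 < m}
      \<union> (if m \<ge> 3 then {{b ! 0, b ! (m - 1)}} else {})"
    by (simp add: block_chords_def Let_def b_def m_def)
  show ?thesis
  proof (intro equalityI subsetI)
    fix c assume "c \<in> block_chords B"
    then consider k where "k + 1 < m" "c = {b ! k, b ! (k + 1)}" | "m \<ge> 3" "c = {b ! 0, b ! (m - 1)}"
      unfolding chords by (auto split: if_splits)
    then show "c \<in> ?R"
    proof cases
      case 1
      have "b ! k \<in> B \<and> b ! (k + 1) \<in> B \<and> b ! k < b ! (k + 1) \<and>
          (\<forall>r\<in>B. r \<le> b ! k \<or> b ! (k + 1) \<le> r)"
        using 1 by (auto intro!: memI simp: less) (auto simp: mem le)
      then show ?thesis unfolding 1 by blast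
    next
      case 2
      have "b ! 0 \<in> B \<and> b ! (m - 1) \<in> B \<and> b ! 0 < b ! (m - 1) \<and>
          (\<forall>r\<in>B. b ! 0 \<le> r \<and> r \<le> b ! (m - 1))"
        using 2 by (auto intro!: memI simp: less) (auto simp: mem le)
      then show ?thesis unfolding 2 by blast
    qed
  next
    fix c assume "c \<in> ?R"
    then obtain i j where c: "c = {b ! i, b ! j}" "i < m" "j < m" "i < j"
      and alt: "(\<forall>r\<in>B. r \<le> b ! i \<or> b ! j \<le> r) \<or> (\<forall>r\<in>B. b ! i \<le> r \<and> r \<le> b ! j)"
      by (auto simp: mem less)
    from alt show "c \<in> block_chords B"
    proof
      assume "\<forall>r\<in>B. r \<le> b ! i \<or> b ! j \<le> r"
      moreover have "b ! (i + 1) \<in> B" using c by (auto intro!: memI)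
      ultimately have "b ! (i + 1) \<le> b ! i \<or> b ! j \<le> b ! (i + 1)" by blast
      then have "j = i + 1" using c by (auto simp: le)
      then show ?thesis unfolding chords using c by auto
    next
      assume *: "\<forall>r\<in>B. b ! i \<le> r \<and> r \<le> b ! j"
      have "b ! 0 \<in> B" "b ! (m - 1) \<in> B" using c by (auto intro!: memI)
      with * have "b ! i \<le> b ! 0" "b ! (m - 1) \<le> b ! j" by blast+
      then have ij: "i = 0" "j = m - 1" using c by (auto simp: le)
      show ?thesis
      proof (cases "m \<ge> 3")
        case True
        then show ?thesis unfolding chords using c ij by auto
      next
        case False
        then have "j = i + 1" using c ij by auto
        then show ?thesis unfolding chords using c by auto
      qed
    qed
  qed
qed

lemma card_block_chords_le: "card (block_chords B) \<le> card B"
proof -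
  define b where "b = sorted_list_of_set B"
  have len: "length b = card B" by (simp add: b_def)
  have eq: "{{b ! k, b ! (k + 1)} | k. k + 1 < length b} = (\<lambda>k. {b ! k, b ! (k + 1)}) ` {..<length b - 1}"
    by auto
  have "card (block_chords B) \<le> card ((\<lambda>k. {b ! k, b ! (k + 1)}) ` {..<length b - 1})
      + card (if length b \<ge> 3 then {{b ! 0, b ! (length b - 1)}} else {})"
    unfolding block_chords_def Let_def b_def[symmetric] eq by (rule card_Un_le)
  also have "\<dots> \<le> (length b - 1) + (if length b \<ge> 3 then 1 else 0)"
    using card_image_le[of "{..<length b - 1}" "\<lambda>k. {b ! k, b ! (k + 1)}"] by auto
  also have "\<dots> \<le> card B" using len by auto
  finally show ?thesis .
qed

lemma finite_block_chords: "finite (block_chords B)"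
  by (auto simp: block_chords_def Let_def intro!: finite_image_set intro: finite_subset[of _ "{..<card B}"])

lemma circular_chords_bound:
  assumes "P \<in> set_partitions n"
  shows finite_circular_chords: "finite (circular_chords P)"
    and card_circular_chords_le: "card (circular_chords P) \<le> n"
proof -
  have P: "partition_on {1..n} P" using assms by (simp add: set_partitions_def)
  then have fin: "finite P" by (rule finite_elements[rotated]) simp
  then show "finite (circular_chords P)"
    by (simp add: circular_chords_def finite_block_chords)
  have "card (circular_chords P) \<le> (\<Sum>B\<in>P. card (block_chords B))"
    unfolding circular_chords_def by (rule card_UN_le[OF fin])
  also have "\<dots> \<le> (\<Sum>B\<in>P. card B)" by (intro sum_mono card_block_chords_le)
  also have "\<dots> = card (\<Union>P)"
  proof (rule card_Union_disjoint[symmetric])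
    show "pairwise disjnt P" using P by (auto simp: partition_on_def pairwise_def disjoint_def disjnt_def)
    show "finite B" if "B \<in> P" for B
      using P that by (intro finite_subset[of B "{1..n}"]) (auto simp: partition_on_def)
  qed
  also have "\<Union>P = {1..n}" using P by (simp add: partition_on_def)
  finally show "card (circular_chords P) \<le> n" by simp
qed

text \<open>
  A crossing pair within \<open>C\<close> that is not one within \<open>D\<close> contains a chord of \<open>C - D\<close>; its partner is
  any of the chords of \<open>C\<close>.
\<close>
lemma crossing_pairs_le:
  fixes C D :: "nat set set"
  assumes "finite C" "finite D"
  shows "card {{c, c'} | c c'. c \<in> C \<and> c' \<in> C \<and> chords_cross c c'}
    \<le> card {{c, c'} | c c'. c \<in> D \<and> c' \<in> D \<and> chords_cross c c'} + card (C - D) * card C"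
    (is "card ?X \<le> card ?Y + _")
proof -
  let ?Z = "(\<lambda>(c, c'). {c, c'}) ` ((C - D) \<times> C)"
  have "?X \<subseteq> ?Y \<union> ?Z"
  proof
    fix e assume "e \<in> ?X"
    then obtain c c' where e: "e = {c, c'}" "c \<in> C" "c' \<in> C" "chords_cross c c'" by blast
    consider "c \<in> D" "c' \<in> D" | "c \<notin> D" | "c' \<notin> D" by blast
    then show "e \<in> ?Y \<union> ?Z"
    proof cases
      case 1
      then show ?thesis using e by blast
    next
      case 2
      then have "e = (\<lambda>(c, c'). {c, c'}) (c, c')" "(c, c') \<in> (C - D) \<times> C" using e by auto
      then show ?thesis by blast
    next
      case 3
      then have "e = (\<lambda>(c, c'). {c, c'}) (c', c)" "(c', c) \<in> (C - D) \<times> C" using e by auto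
      then show ?thesis by blast
    qed
  qed
  moreover have "finite ?Y"
    by (rule finite_subset[of _ "(\<lambda>(c, c'). {c, c'}) ` (D \<times> D)"]) (auto simp: assms)
  ultimately have "card ?X \<le> card (?Y \<union> ?Z)"
    using assms by (intro card_mono) auto
  also have "\<dots> \<le> card ?Y + card ?Z" by (rule card_Un_le)
  also have "card ?Z \<le> card (C - D) * card C"
    using card_image_le[of "(C - D) \<times> C" "\<lambda>(c, c'). {c, c'}"] assms by (simp add: card_cartesian_product)
  finally show ?thesis by simp
qed

definition kernel :: "nat \<Rightarrow> (nat \<Rightarrow> 'a) \<Rightarrow> nat set set" where
  "kernel n x = (\<lambda>i. {j\<in>{1..n}. x j = x i}) ` {1..n}"

lemma kernel_in_set_partitions: "kernel n x \<in> set_partitions n"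
  by (fastforce simp: set_partitions_def kernel_def partition_on_def disjoint_def)

lemma circular_chords_kernel:
  "circular_chords (kernel n x) = {{p, q} |p q. p \<in> {1..n} \<and> q \<in> {1..n} \<and> p < q \<and> x p = x q \<and>
    ((\<forall>r. p < r \<and> r < q \<longrightarrow> x r \<noteq> x p) \<or> (\<forall>r\<in>{1..n}. x r = x p \<longrightarrow> p \<le> r \<and> r \<le> q))}" (is "_ = ?R")
proof (intro equalityI subsetI)
  fix c assume "c \<in> circular_chords (kernel n x)"
  then obtain i where i: "i \<in> {1..n}" "c \<in> block_chords {j\<in>{1..n}. x j = x i}"
    by (auto simp: circular_chords_def kernel_def)
  let ?B = "{j\<in>{1..n}. x j = x i}"
  have "finite ?B" by simp
  from i(2)[unfolded block_chords_eq[OF this]] obtain p q where c: "c = {p, q}" "p \<in> ?B" "q \<in> ?B" "p < q"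
    and alt: "(\<forall>r\<in>?B. r \<le> p \<or> q \<le> r) \<or> (\<forall>r\<in>?B. p \<le> r \<and> r \<le> q)" by blast
  have "(\<forall>r. p < r \<and> r < q \<longrightarrow> x r \<noteq> x p) \<or> (\<forall>r\<in>{1..n}. x r = x p \<longrightarrow> p \<le> r \<and> r \<le> q)"
    using alt
  proof
    assume gap: "\<forall>r\<in>?B. r \<le> p \<or> q \<le> r"
    have "x r \<noteq> x p" if "p < r" "r < q" for r
    proof
      assume "x r = x p"
      with that c have "r \<in> ?B" by auto
      with gap that show False by (meson not_le)
    qed
    then show ?thesis by blast
  next
    assume "\<forall>r\<in>?B. p \<le> r \<and> r \<le> q"
    then show ?thesis using c by auto
  qed
  moreover have "p \<in> {1..n}" "q \<in> {1..n}" "x p = x q" using c by auto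
  ultimately have conj: "c = {p, q} \<and> p \<in> {1..n} \<and> q \<in> {1..n} \<and> p < q \<and> x p = x q \<and>
    ((\<forall>r. p < r \<and> r < q \<longrightarrow> x r \<noteq> x p) \<or> (\<forall>r\<in>{1..n}. x r = x p \<longrightarrow> p \<le> r \<and> r \<le> q))"
    using \<open>c = {p, q}\<close> \<open>p < q\<close> by (intro conjI)
  show "c \<in> ?R" by (rule CollectI, rule exI[of _ p], rule exI[of _ q], rule conj)
next
  fix c assume "c \<in> ?R"
  then obtain p q where c: "c = {p, q}" "p \<in> {1..n}" "q \<in> {1..n}" "p < q" "x p = x q"
    and alt: "(\<forall>r. p < r \<and> r < q \<longrightarrow> x r \<noteq> x p) \<or> (\<forall>r\<in>{1..n}. x r = x p \<longrightarrow> p \<le> r \<and> r \<le> q)" by (elim CollectE exE conjE) (rule that)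
  let ?B = "{j\<in>{1..n}. x j = x p}"
  have "finite ?B" by simp
  moreover have "(\<forall>r\<in>?B. r \<le> p \<or> q \<le> r) \<or> (\<forall>r\<in>?B. p \<le> r \<and> r \<le> q)"
    using alt by (auto simp: not_le)
  moreover have "p \<in> ?B" "q \<in> ?B" using c by auto
  ultimately have conj: "c = {p, q} \<and> p \<in> ?B \<and> q \<in> ?B \<and> p < q \<and>
    ((\<forall>r\<in>?B. r \<le> p \<or> q \<le> r) \<or> (\<forall>r\<in>?B. p \<le> r \<and> r \<le> q))"
    using c(1,4) by (intro conjI)
  have "c \<in> block_chords ?B"
    unfolding block_chords_eq[OF \<open>finite ?B\<close>]
    by (rule CollectI, rule exI[of _ p], rule exI[of _ q], rule conj)
  then show "c \<in> circular_chords (kernel n x)"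
    using c by (auto simp: circular_chords_def kernel_def)
qed

text \<open>
  A chord that disappears when the letter at position \<open>i\<close> changes from \<open>x i\<close> to \<open>y i\<close> either ends at
  \<open>i\<close>, or belongs to the block that \<open>i\<close> joins and becomes a diagonal of its polygon. The first kind joins \<open>i\<close> to its
  successor, predecessor, maximum or minimum in the block it leaves; the second joins the two
  neighbours of \<open>i\<close>, or the two extremes, in the block it joins. This makes six candidates.
\<close>
lemma card_chords_change_le:
  assumes i: "i \<in> {1..n}" and agree: "\<And>j. j \<in> {1..n} \<Longrightarrow> j \<noteq> i \<Longrightarrow> x j = y j"
  shows "card (circular_chords (kernel n x) - circular_chords (kernel n y)) \<le> 6"
proof -
  let ?I = "{1..n}"
  define S1 where "S1 = {{i, q} |q. i < q \<and> x q = x i \<and> (\<forall>r. i < r \<and> r < q \<longrightarrow> x r \<noteq> x i)}"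
  define S2 where "S2 = {{i, q} |q. q \<in> ?I \<and> i < q \<and> x q = x i \<and> (\<forall>r\<in>?I. x r = x i \<longrightarrow> r \<le> q)}"
  define S3 where "S3 = {{p, i} |p. p < i \<and> x p = x i \<and> (\<forall>r. p < r \<and> r < i \<longrightarrow> x r \<noteq> x i)}"
  define S4 where "S4 = {{p, i} |p. p \<in> ?I \<and> p < i \<and> x p = x i \<and> (\<forall>r\<in>?I. x r = x i \<longrightarrow> p \<le> r)}"
  define S5 where "S5 = {{p, q} |p q. p < i \<and> i < q \<and> y p = y i \<and> y q = y i \<and>
    (\<forall>r. p < r \<and> r < q \<and> r \<noteq> i \<longrightarrow> y r \<noteq> y i)}"
  define S6 where "S6 = {{p, q} |p q. p \<in> ?I - {i} \<and> q \<in> ?I - {i} \<and> y p = y i \<and> y q = y i \<and>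
    (\<forall>r\<in>?I - {i}. y r = y i \<longrightarrow> p \<le> r \<and> r \<le> q)}"
  \<comment> \<open>Each of the six sets contains at most one chord, as neighbours and extremes are unique.\<close>
  have single: "finite S \<and> card S \<le> 1" if "\<And>c c'. c \<in> S \<Longrightarrow> c' \<in> S \<Longrightarrow> c = c'" for S :: "nat set set"
  proof (cases "S = {}")
    case False
    then obtain c where "c \<in> S" by blast
    with that have "S = {c}" by blast
    then show ?thesis by simp
  qed simp
  have c1: "finite S1 \<and> card S1 \<le> 1"
    by (rule single) (auto simp: S1_def, (metis linorder_neqE_nat)+)
  have c2: "finite S2 \<and> card S2 \<le> 1"
    by (rule single) (force simp: S2_def intro: order_antisym)
  have c3: "finite S3 \<and> card S3 \<le> 1"
    by (rule single) (auto simp: S3_def, (metis linorder_neqE_nat)+)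
  have c4: "finite S4 \<and> card S4 \<le> 1"
    by (rule single) (force simp: S4_def intro: order_antisym)
  have c5: "finite S5 \<and> card S5 \<le> 1"
  proof (rule single)
    fix c c' assume "c \<in> S5" "c' \<in> S5"
    then obtain p q p' q' where c: "c = {p, q}" "c' = {p', q'}"
      and "p < i" "i < q" "y p = y i" "y q = y i" "p' < i" "i < q'" "y p' = y i" "y q' = y i"
      and 1: "\<And>r. p < r \<Longrightarrow> r < q \<Longrightarrow> r \<noteq> i \<Longrightarrow> y r \<noteq> y i"
      and 2: "\<And>r. p' < r \<Longrightarrow> r < q' \<Longrightarrow> r \<noteq> i \<Longrightarrow> y r \<noteq> y i"
      unfolding S5_def by blast
    then have "\<not> p < p'" "\<not> p' < p" "\<not> q < q'" "\<not> q' < q"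
      using 1[of p'] 2[of p] 1[of q'] 2[of q] by auto
    then show "c = c'" using c by auto
  qed
  have c6: "finite S6 \<and> card S6 \<le> 1"
  proof (rule single)
    fix c c' assume "c \<in> S6" "c' \<in> S6"
    then obtain p q p' q' where c: "c = {p, q}" "c' = {p', q'}"
      and m: "p \<in> ?I - {i}" "q \<in> ?I - {i}" "y p = y i" "y q = y i"
        "p' \<in> ?I - {i}" "q' \<in> ?I - {i}" "y p' = y i" "y q' = y i"
      and 1: "\<And>r. r \<in> ?I - {i} \<Longrightarrow> y r = y i \<Longrightarrow> p \<le> r \<and> r \<le> q"
      and 2: "\<And>r. r \<in> ?I - {i} \<Longrightarrow> y r = y i \<Longrightarrow> p' \<le> r \<and> r \<le> q'"
      unfolding S6_def by blast
    have "p = p'" "q = q'"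
      using 1[OF m(5,7)] 1[OF m(6,8)] 2[OF m(1,3)] 2[OF m(2,4)] by auto
    then show "c = c'" using c by simp
  qed
  have "circular_chords (kernel n x) - circular_chords (kernel n y) \<subseteq> S1 \<union> S2 \<union> S3 \<union> S4 \<union> S5 \<union> S6"
  proof
    fix c assume c: "c \<in> circular_chords (kernel n x) - circular_chords (kernel n y)"
    from c obtain p q where pq: "c = {p, q}" "p \<in> ?I" "q \<in> ?I" "p < q" "x p = x q"
      and alt: "(\<forall>r. p < r \<and> r < q \<longrightarrow> x r \<noteq> x p) \<or> (\<forall>r\<in>?I. x r = x p \<longrightarrow> p \<le> r \<and> r \<le> q)"
      unfolding circular_chords_kernel by blast
    from c pq have no: "\<not> (y p = y q \<and>
        ((\<forall>r. p < r \<and> r < q \<longrightarrow> y r \<noteq> y p) \<or> (\<forall>r\<in>?I. y r = y p \<longrightarrow> p \<le> r \<and> r \<le> q)))"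
      unfolding circular_chords_kernel by blast
    consider "p = i" | "q = i" | "p \<noteq> i" "q \<noteq> i" by blast
    then show "c \<in> S1 \<union> S2 \<union> S3 \<union> S4 \<union> S5 \<union> S6"
    proof cases
      case 1
      then have "c \<in> S1 \<or> c \<in> S2"
        using alt pq unfolding S1_def S2_def by auto
      then show ?thesis by blast
    next
      case 2
      then have "c \<in> S3 \<or> c \<in> S4"
        using alt pq unfolding S3_def S4_def by auto
      then show ?thesis by blast
    next
      case 3
      then have xy: "x p = y p" "x q = y q" using agree pq by auto
      from alt show ?thesis
      proof
        assume g: "\<forall>r. p < r \<and> r < q \<longrightarrow> x r \<noteq> x p"
        have g': "y r \<noteq> y p" if "p < r" "r < q" "r \<noteq> i" for r
          using g that agree[of r] xy pq by auto
        have "\<exists>r. p < r \<and> r < q \<and> y r = y p" using no xy pq by auto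
        then have i: "p < i" "i < q" "y i = y p" using g' by metis+
        have "p < i \<and> i < q \<and> y p = y i \<and> y q = y i \<and> (\<forall>r. p < r \<and> r < q \<and> r \<noteq> i \<longrightarrow> y r \<noteq> y i)"
          using i g' pq xy by auto
        then have "c \<in> S5" using pq unfolding S5_def by blast
        then show ?thesis by blast
      next
        assume g: "\<forall>r\<in>?I. x r = x p \<longrightarrow> p \<le> r \<and> r \<le> q"
        have g': "p \<le> r \<and> r \<le> q" if "r \<in> ?I" "r \<noteq> i" "y r = y p" for r
          using g that agree[of r] xy by auto
        have "\<exists>r\<in>?I. y r = y p \<and> \<not> (p \<le> r \<and> r \<le> q)" using no xy pq by auto
        then have i: "y i = y p" using g' by metis
        have "p \<in> ?I - {i} \<and> q \<in> ?I - {i} \<and> y p = y i \<and> y q = y i \<and>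
            (\<forall>r\<in>?I - {i}. y r = y i \<longrightarrow> p \<le> r \<and> r \<le> q)"
          using i g' pq xy 3 by auto
        then have "c \<in> S6" using pq unfolding S6_def by blast
        then show ?thesis by blast
      qed
    qed
  qed
  then have "card (circular_chords (kernel n x) - circular_chords (kernel n y))
      \<le> card (S1 \<union> S2 \<union> S3 \<union> S4 \<union> S5 \<union> S6)"
    using c1 c2 c3 c4 c5 c6 by (intro card_mono) auto
  also have "\<dots> \<le> card S1 + card S2 + card S3 + card S4 + card S5 + card S6"
    by (intro order_trans[OF card_Un_le] add_mono order_refl)
  also have "\<dots> \<le> 6" using c1 c2 c3 c4 c5 c6 by simp
  finally show ?thesis .
qed

lemma circular_crossings_change_le:
  assumes i: "i \<in> {1..n}" and agree: "\<And>j. j \<in> {1..n} \<Longrightarrow> j \<noteq> i \<Longrightarrow> x j = y j"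
  shows "\<bar>real (circular_crossings (kernel n x)) - real (circular_crossings (kernel n y))\<bar> \<le> 6 * real n"
proof -
  have one: "circular_crossings (kernel n u) \<le> circular_crossings (kernel n v) + 6 * n"
    if "\<And>j. j \<in> {1..n} \<Longrightarrow> j \<noteq> i \<Longrightarrow> u j = v j" for u v :: "nat \<Rightarrow> 'a"
  proof -
    let ?C = "circular_chords (kernel n u)" and ?D = "circular_chords (kernel n v)"
    have "circular_crossings (kernel n u) \<le> circular_crossings (kernel n v) + card (?C - ?D) * card ?C"
      unfolding circular_crossings_def
      by (intro crossing_pairs_le finite_circular_chords[OF kernel_in_set_partitions])
    also have "card (?C - ?D) * card ?C \<le> 6 * n"
      by (intro mult_mono card_chords_change_le[OF i] card_circular_chords_le
          kernel_in_set_partitions that) auto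
    finally show ?thesis by simp
  qed
  show ?thesis using one[of x y] one[of y x] agree by (simp add: abs_le_iff)
qed

section \<open>Uniform partitions as kernels of random words\<close>

text \<open>
  Positions are counted from 1, as in \<open>{1..n}\<close>, whereas list indices start from 0.
\<close>
definition word_kernel :: "nat \<Rightarrow> nat list \<Rightarrow> nat set set" where
  "word_kernel n xs = kernel n (\<lambda>i. xs ! (i - 1))"

lemma kernel_letters_eq:
  assumes "B \<in> kernel n x" "i \<in> B" "j \<in> B"
  shows "x i = x j"
  using assms by (auto simp: kernel_def)

lemma kernel_same_block:
  assumes "B \<in> kernel n x" "i \<in> B" "j \<in> {1..n}" "x i = x j"
  shows "j \<in> B"
  using assms by (auto simp: kernel_def)

text \<open>
  A word with kernel \<open>P\<close> amounts to an injective labelling of the blocks of \<open>P\<close> by letters, encoded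
  here as a list without repetition along a fixed enumeration of the blocks.
\<close>
lemma card_words_with_kernel:
  assumes P: "P \<in> set_partitions n"
  shows "card {xs \<in> words m n. word_kernel n xs = P}
    = card {ys. length ys = card P \<and> distinct ys \<and> set ys \<subseteq> {..<m}}" (is "card ?X = card ?D")
proof -
  have part: "partition_on {1..n} P" using P by (simp add: set_partitions_def)
  then have "finite P" by (rule finite_elements[rotated]) simp
  then obtain Bs where Bs: "set Bs = P" "distinct Bs" by (meson finite_distinct_list)
  define k where "k = card P"
  have len: "length Bs = k" using Bs by (metis distinct_card k_def)
  have inP: "Bs ! j \<in> P" if "j < k" for j using that len Bs by auto
  have inj: "j = j'" if "j < k" "j' < k" "i \<in> Bs ! j" "i \<in> Bs ! j'" for i j j'
  proof -
    have "Bs ! j = Bs ! j'"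
      using part inP that unfolding partition_on_def disjoint_def by blast
    then show ?thesis using Bs that len nth_eq_iff_index_eq by metis
  qed
  \<comment> \<open>The number of the block that contains \<open>i\<close>, and a representative of block number \<open>j\<close>.\<close>
  define lab where "lab i = (SOME j. j < k \<and> i \<in> Bs ! j)" for i
  have "\<exists>j. j < k \<and> i \<in> Bs ! j" if "i \<in> {1..n}" for i
  proof -
    have "i \<in> \<Union>P" using that unfolding partition_onD1[OF part] .
    then obtain B where "B \<in> P" "i \<in> B" by blast
    then obtain j where "j < length Bs" "Bs ! j = B" using Bs(1) by (auto simp: in_set_conv_nth)
    then show ?thesis using \<open>i \<in> B\<close> len by blast
  qed
  then have lab: "lab i < k" "i \<in> Bs ! lab i" if "i \<in> {1..n}" for i
    using someI_ex[of "\<lambda>j. j < k \<and> i \<in> Bs ! j"] that by (simp_all add: lab_def)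
  define rep where "rep j = (SOME i. i \<in> Bs ! j \<and> i \<in> {1..n})" for j
  have "\<exists>i. i \<in> Bs ! j \<and> i \<in> {1..n}" if "j < k" for j
  proof -
    have "Bs ! j \<noteq> {}" using inP[OF that] part by (auto simp: partition_on_def)
    moreover have "Bs ! j \<subseteq> {1..n}" unfolding partition_onD1[OF part] using inP[OF that] by blast
    ultimately show ?thesis by blast
  qed
  then have rep: "rep j \<in> Bs ! j" "rep j \<in> {1..n}" if "j < k" for j
    using someI_ex[of "\<lambda>i. i \<in> Bs ! j \<and> i \<in> {1..n}"] that unfolding rep_def by blast+
  have blocks_sub: "i \<in> {1..n}" if "j < k" "i \<in> Bs ! j" for i j
    unfolding partition_onD1[OF part] using inP[OF that(1)] that(2) by blast
  have lab_rep: "lab (rep j) = j" if "j < k" for j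
    using inj[of "lab (rep j)" j "rep j"] lab[OF rep(2)[OF that]] rep(1)[OF that] that by blast
  define spread where "spread ys = map (\<lambda>i. ys ! lab (Suc i)) [0..<n]" for ys :: "nat list"
  define pick where "pick xs = map (\<lambda>j. xs ! (rep j - 1)) [0..<k]" for xs :: "nat list"
  have spread_nth: "spread ys ! (i - 1) = ys ! lab i" if "i \<in> {1..n}" for ys i
    using that unfolding spread_def by (cases i) auto
  have "bij_betw spread ?D ?X"
  proof (rule bij_betw_byWitness[where f' = pick])
    show "\<forall>ys\<in>?D. pick (spread ys) = ys"
    proof
      fix ys assume "ys \<in> ?D"
      then show "pick (spread ys) = ys"
        using spread_nth[OF rep(2)] lab_rep by (intro nth_equalityI) (auto simp: pick_def k_def)
    qed
    show "\<forall>xs\<in>?X. spread (pick xs) = xs"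
    proof
      fix xs assume xs: "xs \<in> ?X"
      show "spread (pick xs) = xs"
      proof (rule nth_equalityI)
        show "length (spread (pick xs)) = length xs" using xs by (simp add: spread_def words_def)
        fix i assume "i < length (spread (pick xs))"
        then have i: "i < n" "Suc i \<in> {1..n}" by (auto simp: spread_def)
        have "Bs ! lab (Suc i) \<in> kernel n (\<lambda>i. xs ! (i - 1))"
          using inP lab(1) i(2) xs by (auto simp: word_kernel_def)
        from kernel_letters_eq[OF this rep(1)[OF lab(1)[OF i(2)]] lab(2)[OF i(2)]]
        show "spread (pick xs) ! i = xs ! i"
          using i lab(1)[OF i(2)] by (simp add: spread_def pick_def)
      qed
    qed
    show "spread ` ?D \<subseteq> ?X"
    proof (rule image_subsetI)
      fix ys assume "ys \<in> ?D"
      then have ys: "length ys = card P" "distinct ys" "set ys \<subseteq> {..<m}" by simp_all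
      have "ys ! lab i < m" if "i \<in> {1..n}" for i
        using lab(1)[OF that] ys nth_mem[of "lab i" ys] by (force simp: k_def simp del: nth_mem)
      then have words: "spread ys \<in> words m n"
        by (auto simp: words_def spread_def)
      have "{j \<in> {1..n}. spread ys ! (j - 1) = spread ys ! (i - 1)} = Bs ! lab i" if i: "i \<in> {1..n}" for i
      proof -
        have "{j \<in> {1..n}. spread ys ! (j - 1) = spread ys ! (i - 1)} = {j \<in> {1..n}. lab j = lab i}"
          using spread_nth i lab(1) ys by (auto simp: nth_eq_iff_index_eq k_def)
        also have "\<dots> = Bs ! lab i"
        proof (intro equalityI subsetI)
          fix j assume "j \<in> Bs ! lab i"
          moreover from this have "j \<in> {1..n}"
            using blocks_sub[OF lab(1)[OF i]] by blast
          ultimately show "j \<in> {j \<in> {1..n}. lab j = lab i}"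
            using inj[of "lab j" "lab i" j] lab[of j] lab(1)[OF i] by blast
        qed (use lab(2) in force)
        finally show ?thesis .
      qed
      then have "word_kernel n (spread ys) = (\<lambda>i. Bs ! lab i) ` {1..n}"
        unfolding word_kernel_def kernel_def by (rule image_cong[OF refl])
      also have "\<dots> = P"
      proof (intro equalityI subsetI)
        fix B assume "B \<in> P"
        then obtain j where "j < k" "B = Bs ! j" using Bs len by (metis in_set_conv_nth)
        then have "B = Bs ! lab (rep j)" "rep j \<in> {1..n}" using lab_rep rep(2) by auto
        then show "B \<in> (\<lambda>i. Bs ! lab i) ` {1..n}" by blast
      qed (use inP lab(1) in blast)
      finally show "spread ys \<in> ?X" using words by simp
    qed
    show "pick ` ?X \<subseteq> ?D"
    proof (rule image_subsetI)
      fix xs assume "xs \<in> ?X"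
      then have xs: "xs \<in> words m n" and P_eq: "P = word_kernel n xs" by simp_all
      have "j = j'" if j: "j < k" "j' < k" "xs ! (rep j - 1) = xs ! (rep j' - 1)" for j j'
      proof -
        have "rep j' \<in> Bs ! j"
          using kernel_same_block[of "Bs ! j" n "\<lambda>i. xs ! (i - 1)" "rep j" "rep j'"] inP rep j P_eq
          by (simp add: word_kernel_def)
        then show ?thesis using inj rep(1) j by blast
      qed
      then have "distinct (pick xs)"
        by (auto simp: pick_def distinct_map inj_on_def)
      moreover have "set (pick xs) \<subseteq> {..<m}"
      proof
        fix a assume "a \<in> set (pick xs)"
        then obtain j where j: "j < k" "a = xs ! (rep j - 1)" by (auto simp: pick_def)
        have "rep j - 1 < length xs" using rep(2)[OF j(1)] xs by (auto simp: words_def)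
        then have "a \<in> set xs" using j by simp
        then show "a \<in> {..<m}" using xs by (auto simp: words_def)
      qed
      moreover have "length (pick xs) = card P" by (simp add: pick_def k_def)
      ultimately show "pick xs \<in> ?D" by simp
    qed
  qed
  from bij_betw_same_card[OF this] show ?thesis by (rule sym)
qed

text \<open>
  The terms vanish for fewer letters than blocks, and the remaining ones are those of the
  exponential series: \<open>j + k\<close> letters for \<open>k\<close> blocks give \<open>(j + k)! / j!\<close> words.
\<close>
lemma sums_words_with_kernel:
  assumes P: "P \<in> set_partitions n"
  shows "(\<lambda>m. real (card {xs \<in> words m n. word_kernel n xs = P}) / fact m) sums exp 1"
proof -
  let ?f = "\<lambda>m. real (card {xs \<in> words m n. word_kernel n xs = P}) / fact m"
  define k where "k = card P"
  have small: "?f m = 0" if "m < k" for m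
  proof -
    have empty: "{ys. length ys = k \<and> distinct ys \<and> set ys \<subseteq> {..<m}} = {}"
    proof (safe, goal_cases)
      case (1 ys)
      then have "card (set ys) \<le> card {..<m}" by (intro card_mono) auto
      with 1 that show ?case by (simp add: distinct_card)
    qed
    show ?thesis
      unfolding card_words_with_kernel[OF P] k_def[symmetric] empty by simp
  qed
  have "?f (j + k) = 1 / fact j" for j
  proof -
    have "real (card {xs \<in> words (j + k) n. word_kernel n xs = P}) = real (\<Prod>{j + 1..j + k})"
      using card_lists_distinct_length_eq[of "{..<j + k}" k] card_words_with_kernel[OF P, of "j + k"]
      by (simp add: k_def)
    also have "(\<Prod>{j + 1..j + k}) = fact (j + k) div fact j"
      using fact_div_fact[of j "j + k"] by simp
    also have "real (fact (j + k) div fact j) = fact (j + k) / fact j"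
      by (simp add: real_of_nat_div fact_dvd)
    finally show ?thesis by simp
  qed
  then have "(\<lambda>j. ?f (j + k)) sums exp 1"
    using exp_converges[of "1::real"] by (simp add: divide_inverse)
  then show ?thesis using sums_zero_iff_shift[of k ?f] small by blast
qed

lemma weight_times_word_mean:
  "dobinski_weight n m * word_mean m n h = (\<Sum>xs\<in>words m n. h xs) / fact m"
proof (cases "m ^ n = 0")
  case True
  then have "card (words m n) = 0" by (simp only: card_words)
  then have "words m n = {}" using finite_words by (simp only: card_0_eq)
  then show ?thesis by (simp add: word_mean_def)
qed (simp add: dobinski_weight_def word_mean_def)

text \<open>
  Summation over partitions is turned into summation over alphabets and words. For a constant \<open>F\<close>
  this is Dobinski's formula. Both the normalisation and the second moment of the number of crossings
  come from it.
\<close>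
lemma dobinski_sums:
  fixes F :: "nat set set \<Rightarrow> real"
  shows "(\<lambda>m. dobinski_weight n m * word_mean m n (\<lambda>xs. F (word_kernel n xs)))
    sums (exp 1 * (\<Sum>P\<in>set_partitions n. F P))"
proof -
  have "(\<lambda>m. \<Sum>P\<in>set_partitions n. real (card {xs \<in> words m n. word_kernel n xs = P}) / fact m * F P)
      sums (\<Sum>P\<in>set_partitions n. exp 1 * F P)"
    by (intro sums_sum sums_mult2 sums_words_with_kernel)
  moreover have "(\<Sum>P\<in>set_partitions n. real (card {xs \<in> words m n. word_kernel n xs = P}) / fact m * F P)
      = dobinski_weight n m * word_mean m n (\<lambda>xs. F (word_kernel n xs))" for m
  proof -
    have "(\<Sum>xs\<in>words m n. F (word_kernel n xs))
        = (\<Sum>P\<in>set_partitions n. \<Sum>xs | xs \<in> words m n \<and> word_kernel n xs = P. F (word_kernel n xs))"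
      by (rule sum.group[symmetric])
        (auto simp: finite_words finite_set_partitions word_kernel_def kernel_in_set_partitions)
    also have "\<dots> = (\<Sum>P\<in>set_partitions n. real (card {xs \<in> words m n. word_kernel n xs = P}) * F P)"
      by (intro sum.cong refl) simp
    finally show ?thesis
      by (simp add: weight_times_word_mean sum_divide_distrib)
  qed
  ultimately show ?thesis by (simp add: sum_distrib_left)
qed

section \<open>The variance of the number of crossings\<close>

lemma bounded_differences_crossings:
  "bounded_differences n (6 * real n) (\<lambda>xs. real (circular_crossings (word_kernel n xs)))"
  unfolding bounded_differences_def word_kernel_def
proof (intro allI impI)
  fix xs :: "nat list" and i a
  assume "length xs = n" "i < n"
  then show "\<bar>real (circular_crossings (kernel n (\<lambda>i. xs ! (i - 1))))
      - real (circular_crossings (kernel n (\<lambda>j. xs[i := a] ! (j - 1))))\<bar> \<le> 6 * real n"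
    by (intro circular_crossings_change_le[of "Suc i"]) (auto simp: nth_list_update)
qed

text \<open>
  The deviation is measured from the mean over words in the most likely alphabet rather than from
  the mean over partitions. This costs nothing, since the variance is the least mean square
  deviation from a constant, and it makes every alphabet comparable with one fixed alphabet.
\<close>
lemma sum_square_deviation_le:
  fixes F :: "nat set set \<Rightarrow> real"
  assumes n: "0 < n" and L: "bounded_differences n L (\<lambda>xs. F (word_kernel n xs))"
  defines "c \<equiv> word_mean (weight_mode n) n (\<lambda>xs. F (word_kernel n xs))"
  shows "(\<Sum>P\<in>set_partitions n. (F P - c)\<^sup>2)
    \<le> (real n * L\<^sup>2 + 48 * (real n)\<^sup>2 * L\<^sup>2 / real (weight_mode n)) * real (card (set_partitions n))"
proof -
  let ?w = "dobinski_weight n"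
  define k where "k = weight_mode n"
  define h where "h xs = F (word_kernel n xs)" for xs
  define W where "W = exp 1 * real (card (set_partitions n))"
  define A where "A = 4 * (real n)\<^sup>2 * L\<^sup>2 / (real k)\<^sup>2"
  have k: "0 < k" by (simp add: k_def weight_mode_pos)
  have h: "bounded_differences n L h" using L by (simp add: h_def[abs_def])
  have c: "c = word_mean k n h" by (simp add: c_def k_def h_def[abs_def])
  have W: "?w sums W"
  proof -
    have "(\<lambda>m. ?w m * word_mean m n (\<lambda>xs. 1)) = ?w"
      unfolding weight_times_word_mean by (simp add: dobinski_weight_def fun_eq_iff card_words)
    then show ?thesis using dobinski_sums[of n "\<lambda>_. 1"] by (simp only: W_def) simp
  qed
  \<comment> \<open>Conditional variance for \<open>m\<close> letters, plus the squared change of mean between \<open>m\<close> and \<open>k\<close> letters.\<close>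
  have step: "?w m * word_mean m n (\<lambda>xs. (h xs - c)\<^sup>2)
      \<le> real n * L\<^sup>2 * ?w m + A * (?w m * (real m - real k)\<^sup>2)" for m
  proof (cases "m = 0")
    case True
    then have "?w m = 0" using n by (simp add: dobinski_weight_def)
    then show ?thesis by simp
  next
    case False
    then have m: "0 < m" by simp
    have "\<bar>word_mean m n h - c\<bar> \<le> 2 * real n * L * \<bar>real m - real k\<bar> / real k"
    proof (cases "m \<le> k")
      case True
      then show ?thesis
        using word_mean_alphabet_le[OF m True h] by (simp add: c abs_minus_commute)
    next
      case False
      have L0: "0 \<le> L"
        using h n unfolding bounded_differences_def
        by (metis abs_ge_zero length_replicate order_trans)
      have "\<bar>word_mean m n h - c\<bar> \<le> 2 * real n * L * (real m - real k) / real m"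
        using word_mean_alphabet_le[OF k _ h, of m] False by (simp add: c)
      also have "\<dots> \<le> 2 * real n * L * (real m - real k) / real k"
        using False k L0 by (intro divide_left_mono mult_nonneg_nonneg) auto
      finally show ?thesis using False by simp
    qed
    then have "(word_mean m n h - c)\<^sup>2 \<le> (2 * real n * L * \<bar>real m - real k\<bar> / real k)\<^sup>2"
      by (metis abs_ge_zero power2_abs power_mono)
    also have "\<dots> = A * (real m - real k)\<^sup>2"
      by (simp add: A_def power_mult_distrib power_divide)
    finally have "word_mean m n (\<lambda>xs. (h xs - c)\<^sup>2) \<le> real n * L\<^sup>2 + A * (real m - real k)\<^sup>2"
      using word_mean_square_le[OF m h, of c] by simp
    from mult_left_mono[OF this dobinski_weight_nonneg[of n m]]
    show ?thesis by (simp add: algebra_simps)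
  qed
  have total: "(\<lambda>m. ?w m * word_mean m n (\<lambda>xs. (h xs - c)\<^sup>2))
      sums (exp 1 * (\<Sum>P\<in>set_partitions n. (F P - c)\<^sup>2))"
    unfolding h_def by (rule dobinski_sums)
  have "(\<Sum>m. ?w m * word_mean m n (\<lambda>xs. (h xs - c)\<^sup>2)) \<le> (real n * L\<^sup>2 + A * (12 * real k)) * W"
  proof (rule suminf_le_const)
    show "summable (\<lambda>m. ?w m * word_mean m n (\<lambda>xs. (h xs - c)\<^sup>2))"
      using total by (rule sums_summable)
    fix N
    have "(\<Sum>m<N. ?w m * word_mean m n (\<lambda>xs. (h xs - c)\<^sup>2))
        \<le> real n * L\<^sup>2 * (\<Sum>m<N. ?w m) + A * (\<Sum>m<N. ?w m * (real m - real k)\<^sup>2)"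
      unfolding sum_distrib_left sum.distrib[symmetric] by (intro sum_mono step)
    also have "\<dots> \<le> real n * L\<^sup>2 * W + A * (12 * real k * W)"
    proof (intro add_mono mult_left_mono)
      show "(\<Sum>m<N. ?w m) \<le> W"
        using sum_le_suminf[OF sums_summable[OF W], of "{..<N}"] W
        by (simp add: dobinski_weight_nonneg sums_iff)
      show "(\<Sum>m<N. ?w m * (real m - real k)\<^sup>2) \<le> 12 * real k * W"
        unfolding k_def by (rule weight_concentration[OF n W])
    qed (auto simp: A_def)
    finally show "(\<Sum>m<N. ?w m * word_mean m n (\<lambda>xs. (h xs - c)\<^sup>2))
        \<le> (real n * L\<^sup>2 + A * (12 * real k)) * W"
      by (simp add: algebra_simps)
  qed
  also have "A * (12 * real k) = 48 * (real n)\<^sup>2 * L\<^sup>2 / real k"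
    using k by (simp add: A_def power2_eq_square)
  finally show ?thesis
    using total by (simp add: sums_iff W_def k_def mult.assoc mult.left_commute)
qed

lemma variance_pmf_of_set_le:
  fixes F :: "'a \<Rightarrow> real"
  assumes "finite S" "S \<noteq> {}"
  shows "measure_pmf.variance (pmf_of_set S) F \<le> (\<Sum>s\<in>S. (F s - c)\<^sup>2) / real (card S)"
proof -
  define \<mu> where "\<mu> = measure_pmf.expectation (pmf_of_set S) F"
  have S: "0 < real (card S)" using assms by (simp add: card_gt_0_iff)
  have \<mu>: "(\<Sum>s\<in>S. F s) = real (card S) * \<mu>"
    using S assms by (simp add: \<mu>_def integral_pmf_of_set)
  have "(\<Sum>s\<in>S. (F s - c)\<^sup>2)
      = (\<Sum>s\<in>S. (F s - \<mu>)\<^sup>2 + (\<mu> - c)\<^sup>2 + 2 * (\<mu> - c) * (F s - \<mu>))"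
    by (intro sum.cong refl) (simp add: power2_eq_square algebra_simps)
  also have "\<dots> = (\<Sum>s\<in>S. (F s - \<mu>)\<^sup>2) + real (card S) * (\<mu> - c)\<^sup>2"
    by (simp add: sum.distrib sum_distrib_left[symmetric] sum_subtractf \<mu>)
  finally have "(\<Sum>s\<in>S. (F s - \<mu>)\<^sup>2) \<le> (\<Sum>s\<in>S. (F s - c)\<^sup>2)" by simp
  then have "(\<Sum>s\<in>S. (F s - \<mu>)\<^sup>2) / real (card S) \<le> (\<Sum>s\<in>S. (F s - c)\<^sup>2) / real (card S)"
    by (rule divide_right_mono) simp
  then show ?thesis
    using assms by (simp add: \<mu>_def[symmetric] integral_pmf_of_set)
qed

lemma variance_crossings_le:
  assumes n: "0 < n"
  shows "measure_pmf.variance (pmf_of_set (set_partitions n)) (\<lambda>P. real (circular_crossings P))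
    \<le> 36 * real n ^ 3 + 1728 * real n ^ 4 / sqrt (real n)"
proof -
  let ?k = "real (weight_mode n)" and ?N = "real (card (set_partitions n))"
  let ?c = "word_mean (weight_mode n) n (\<lambda>xs. real (circular_crossings (word_kernel n xs)))"
  have N: "0 < ?N" using finite_set_partitions set_partitions_nonempty by (simp add: card_gt_0_iff)
  have "sqrt (real n) \<le> ?k"
    using le_weight_mode_square[of n] by (intro real_le_lsqrt) (simp_all flip: of_nat_power)
  have "measure_pmf.variance (pmf_of_set (set_partitions n)) (\<lambda>P. real (circular_crossings P))
      \<le> (\<Sum>P\<in>set_partitions n. (real (circular_crossings P) - ?c)\<^sup>2) / ?N"
    by (rule variance_pmf_of_set_le[OF finite_set_partitions set_partitions_nonempty])
  also have "\<dots> \<le> real n * (6 * real n)\<^sup>2 + 48 * (real n)\<^sup>2 * (6 * real n)\<^sup>2 / ?k"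
    using sum_square_deviation_le[OF n bounded_differences_crossings] N by (simp add: divide_le_eq)
  also have "\<dots> \<le> real n * (6 * real n)\<^sup>2 + 48 * (real n)\<^sup>2 * (6 * real n)\<^sup>2 / sqrt (real n)"
    using \<open>sqrt (real n) \<le> ?k\<close> n by (intro add_left_mono divide_left_mono mult_pos_pos)
      (auto simp: weight_mode_pos)
  also have "\<dots> = 36 * real n ^ 3 + 1728 * real n ^ 4 / sqrt (real n)"
    by (simp add: power2_eq_square power3_eq_cube power4_eq_xxxx)
  finally show ?thesis .
qed

theorem theorem1p10:
  shows "(\<lambda>n. measure_pmf.variance (pmf_of_set (set_partitions n))
                (\<lambda>P. real (circular_crossings P)))
         \<in> O(\<lambda>n. real n ^ 4 / (ln (real n)) ^ 4)"
proof -
  have "(\<lambda>n. measure_pmf.variance (pmf_of_set (set_partitions n)) (\<lambda>P. real (circular_crossings P)))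
      \<in> O(\<lambda>n. 36 * real n ^ 3 + 1728 * real n ^ 4 / sqrt (real n))"
  proof (rule bigoI[where c = 1])
    show "eventually (\<lambda>n. norm (measure_pmf.variance (pmf_of_set (set_partitions n))
        (\<lambda>P. real (circular_crossings P))) \<le> 1 * norm (36 * real n ^ 3 + 1728 * real n ^ 4 / sqrt (real n))) sequentially"
      using eventually_gt_at_top[of 0]
    proof eventually_elim
      case (elim n)
      have "0 \<le> measure_pmf.variance (pmf_of_set (set_partitions n)) (\<lambda>P. real (circular_crossings P))"
        by (rule measure_pmf.variance_positive)
      then show ?case using variance_crossings_le[OF elim] by simp
    qed
  qed
  also have "(\<lambda>n. 36 * real n ^ 3 + 1728 * real n ^ 4 / sqrt (real n)) \<in> O(\<lambda>n. real n ^ 4 / (ln (real n)) ^ 4)"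
    by real_asymp
  finally show ?thesis .
qed

end
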